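(* All cubes in $\mathcal{C}^3_3(v,v,0)$ are of propriety $d=2$, and they are equivalent to Latin squares of order $v$.
   Context: A $v\times v\times v$ array is a function on $\{1,\dots,v\}^3$. A layer is a 2-dimensional subarray obtained by fixing one of the three coordinates. Two layers are parallel if they fix the same coordinate, to different values; their scalar product is the sum over all positions of the product of corresponding entries. $\mathcal{C}^3_3(v,k,\lambda)$ is the set of $v\times v\times v$ arrays over $\{0,1\}$ (called cubes of propriety 3) such that every layer, in each of the three directions, contains exactly $k$ ones and every two parallel layers have scalar product $\lambda$. A cube is of propriety $2$ if, for some $k',\lambda'$, every layer of it is an incidence matrix of a symmetric $(v,k',\lambda')$ design, i.e. a $v\times v$ matrix over $\{0,1\}$ with exactly $k'$ ones in every row and column and with scalar product $\lambda'$ for any two distinct rows and any two distinct columns. A Latin square of order $v$ is a $v\times v$ matrix $L$ over $\{1,\dots,v\}$ in which each symbol appears exactly once in every row and column. The equivalence between cubes $A$ and Latin squares $L$ is understood in the sense of the correspondence $A\leftrightarrow L$ in which $A(x,y,z)=1$ if $L(x,y)=z$, and $A(x,y,z)=0$ otherwise. *)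

theory Defs
  imports Main "HOL-Library.FuncSet"
begin

text \<open>Arrays are extensional functions on powers of \<open>{1..v}\<close>, so that equality of arrays is
  equality of their entries.\<close>

definition binary_cubes :: "nat \<Rightarrow> (nat \<times> nat \<times> nat \<Rightarrow> nat) set" where
  "binary_cubes v = ({1..v} \<times> {1..v} \<times> {1..v}) \<rightarrow>\<^sub>E {0, 1}"

datatype coord = X | Y | Z

text \<open>The layer obtained by fixing coordinate \<open>d\<close> to the value \<open>i\<close>; the remaining two coordinates
  keep their order. Its entries are meaningful only on \<open>{1..v} \<times> {1..v}\<close>.\<close>

fun layer :: "(nat \<times> nat \<times> nat \<Rightarrow> nat) \<Rightarrow> coord \<Rightarrow> nat \<Rightarrow> nat \<times> nat \<Rightarrow> nat" where
  "layer A X i = (\<lambda>(p, q). A (i, p, q))"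
| "layer A Y i = (\<lambda>(p, q). A (p, i, q))"
| "layer A Z i = (\<lambda>(p, q). A (p, q, i))"

definition layer_product :: "nat \<Rightarrow> (nat \<times> nat \<Rightarrow> nat) \<Rightarrow> (nat \<times> nat \<Rightarrow> nat) \<Rightarrow> nat" where
  "layer_product v M N = (\<Sum>p\<in>{1..v} \<times> {1..v}. M p * N p)"

text \<open>\<open>\<C>\<^sup>3\<^sub>3(v,k,\<lambda>)\<close>: the \<open>v \<times> v \<times> v\<close> cubes of propriety 3.\<close>

definition propriety3_cubes :: "nat \<Rightarrow> nat \<Rightarrow> nat \<Rightarrow> (nat \<times> nat \<times> nat \<Rightarrow> nat) set" where
  "propriety3_cubes v k l = {A \<in> binary_cubes v.
     (\<forall>d. \<forall>i\<in>{1..v}. card {p \<in> {1..v} \<times> {1..v}. layer A d i p = 1} = k) \<and>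
     (\<forall>d. \<forall>i\<in>{1..v}. \<forall>j\<in>{1..v}. i \<noteq> j \<longrightarrow>
        layer_product v (layer A d i) (layer A d j) = l)}"

definition symmetric_design_matrix :: "nat \<Rightarrow> nat \<Rightarrow> nat \<Rightarrow> (nat \<times> nat \<Rightarrow> nat) \<Rightarrow> bool" where
  "symmetric_design_matrix v k l M \<longleftrightarrow>
     (\<forall>r\<in>{1..v}. \<forall>c\<in>{1..v}. M (r, c) \<in> {0, 1}) \<and>
     (\<forall>r\<in>{1..v}. card {c \<in> {1..v}. M (r, c) = 1} = k) \<and>
     (\<forall>c\<in>{1..v}. card {r \<in> {1..v}. M (r, c) = 1} = k) \<and>
     (\<forall>r\<in>{1..v}. \<forall>s\<in>{1..v}. r \<noteq> s \<longrightarrow> (\<Sum>c\<in>{1..v}. M (r, c) * M (s, c)) = l) \<and>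
     (\<forall>c\<in>{1..v}. \<forall>d\<in>{1..v}. c \<noteq> d \<longrightarrow> (\<Sum>r\<in>{1..v}. M (r, c) * M (r, d)) = l)"

text \<open>The parameters \<open>k\<close> and \<open>l\<close> are common to all layers in all three directions.\<close>

definition propriety2 :: "nat \<Rightarrow> (nat \<times> nat \<times> nat \<Rightarrow> nat) \<Rightarrow> bool" where
  "propriety2 v A \<longleftrightarrow> A \<in> binary_cubes v \<and>
     (\<exists>k l. \<forall>d. \<forall>i\<in>{1..v}. symmetric_design_matrix v k l (layer A d i))"

definition latin_squares :: "nat \<Rightarrow> (nat \<times> nat \<Rightarrow> nat) set" where
  "latin_squares v = {L \<in> ({1..v} \<times> {1..v}) \<rightarrow>\<^sub>E {1..v}.
     (\<forall>x\<in>{1..v}. \<forall>s\<in>{1..v}. \<exists>!y. y \<in> {1..v} \<and> L (x, y) = s) \<and>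
     (\<forall>y\<in>{1..v}. \<forall>s\<in>{1..v}. \<exists>!x. x \<in> {1..v} \<and> L (x, y) = s)}"

definition latin_cube :: "nat \<Rightarrow> (nat \<times> nat \<Rightarrow> nat) \<Rightarrow> (nat \<times> nat \<times> nat \<Rightarrow> nat)" where
  "latin_cube v L = (\<lambda>(x, y, z) \<in> {1..v} \<times> {1..v} \<times> {1..v}. if L (x, y) = z then 1 else 0)"

end

theory Submission
  imports Defs
begin

text \<open>Orthogonality of the parallel layers makes their supports disjoint. In each direction there
  are \<open>v\<close> of them with \<open>v\<close> ones each, so together they fill all \<open>v\<^sup>2\<close> positions: every axis-parallel
  line of the cube contains exactly one 1. Hence every layer is a permutation matrix, that is, a
  symmetric \<open>(v, 1, 0)\<close> design, and the position of the 1 on the line in the third direction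
  through \<open>(x, y)\<close> is the entry \<open>L(x, y)\<close> of a Latin square.\<close>

section \<open>Axis-parallel lines of a cube\<close>

definition single_one_lines :: "nat \<Rightarrow> (nat \<times> nat \<times> nat \<Rightarrow> nat) \<Rightarrow> bool" where
  "single_one_lines v A \<longleftrightarrow>
     (\<forall>d. \<forall>p\<in>{1..v} \<times> {1..v}. \<exists>!i. i \<in> {1..v} \<and> layer A d i p = 1)"

text \<open>For a fixed position \<open>p\<close>, the entries \<open>layer A d i p\<close> with
  varying \<open>i\<close> run along the line in direction \<open>d\<close> through
  \<open>p\<close>; the three values of \<open>d\<close> give the three families of lines.\<close>

lemma single_one_lines_iff:
  "single_one_lines v A \<longleftrightarrow>
     (\<forall>p\<in>{1..v}. \<forall>q\<in>{1..v}. \<exists>!i. i \<in> {1..v} \<and> A (i, p, q) = 1) \<and>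
     (\<forall>p\<in>{1..v}. \<forall>q\<in>{1..v}. \<exists>!i. i \<in> {1..v} \<and> A (p, i, q) = 1) \<and>
     (\<forall>p\<in>{1..v}. \<forall>q\<in>{1..v}. \<exists>!i. i \<in> {1..v} \<and> A (p, q, i) = 1)"
proof -
  have all_coord: "(\<forall>d. P d) \<longleftrightarrow> P X \<and> P Y \<and> P Z" for P
    by (metis coord.exhaust)
  show ?thesis
    unfolding single_one_lines_def all_coord by simp
qed

lemma single_one_linesD:
  assumes "single_one_lines v A" "p \<in> {1..v}" "q \<in> {1..v}"
  shows "\<exists>!i. i \<in> {1..v} \<and> A (i, p, q) = 1"
    and "\<exists>!i. i \<in> {1..v} \<and> A (p, i, q) = 1"
    and "\<exists>!i. i \<in> {1..v} \<and> A (p, q, i) = 1"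
  using assms by (simp_all only: single_one_lines_iff)

section \<open>Counting arguments\<close>

text \<open>By disjointness the union has \<open>card I * k\<close> elements, as many as the finite
  set \<open>P\<close> containing it, so it is all of \<open>P\<close>. This gives existence;
  disjointness gives uniqueness.\<close>

lemma disjoint_covering_ex1:
  fixes S :: "'i \<Rightarrow> 'a set"
  assumes "finite I" "finite P"
    and sub: "\<And>i. i \<in> I \<Longrightarrow> S i \<subseteq> P"
    and card: "\<And>i. i \<in> I \<Longrightarrow> card (S i) = k"
    and disj: "\<And>i j. i \<in> I \<Longrightarrow> j \<in> I \<Longrightarrow> i \<noteq> j \<Longrightarrow> S i \<inter> S j = {}"
    and total: "card I * k = card P"
    and "p \<in> P"
  shows "\<exists>!i. i \<in> I \<and> p \<in> S i"
proof -
  have "card (\<Union>i\<in>I. S i) = (\<Sum>i\<in>I. card (S i))"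
    using assms(1,2) sub disj by (intro card_UN_disjoint) (auto intro: finite_subset)
  also have "\<dots> = card P"
    using card total by simp
  finally have "(\<Union>i\<in>I. S i) = P"
    using assms(2) sub by (intro card_subset_eq) auto
  then obtain i where "i \<in> I" "p \<in> S i"
    using \<open>p \<in> P\<close> by blast
  then show ?thesis
    using disj by blast
qed

text \<open>The relation is the graph of a function on \<open>I\<close>. It serves to count the ones
  of a layer row by row.\<close>

lemma card_functional_relation:
  assumes "finite I" "\<And>p. p \<in> I \<Longrightarrow> \<exists>!q. q \<in> J \<and> R p q"
  shows "card {(p, q). p \<in> I \<and> q \<in> J \<and> R p q} = card I"
proof -
  define g where "g = (\<lambda>p. THE q. q \<in> J \<and> R p q)"
  have g: "g p \<in> J \<and> R p (g p)" if "p \<in> I" for p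
    unfolding g_def by (rule theI'[OF assms(2)[OF that]])
  have "{(p, q). p \<in> I \<and> q \<in> J \<and> R p q} = (\<lambda>p. (p, g p)) ` I"
    using g assms(2) by blast
  then show ?thesis
    by (simp add: card_image inj_on_def)
qed

lemma card_ex1:
  assumes "\<exists>!x. x \<in> S \<and> P x"
  shows "card {x \<in> S. P x} = 1"
proof -
  obtain x where "{x \<in> S. P x} = {x}"
    using assms by blast
  then show ?thesis
    by simp
qed

section \<open>Orthogonal layers and single-one lines\<close>

lemma binary_cube_entry:
  assumes "A \<in> binary_cubes v" "x \<in> {1..v}" "y \<in> {1..v}" "z \<in> {1..v}"
  shows "A (x, y, z) \<in> {0, 1}"
  using assms unfolding binary_cubes_def by (auto dest!: PiE_mem[where x = "(x, y, z)"])

lemma binary_cube_layer_entry: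
  assumes "A \<in> binary_cubes v" "i \<in> {1..v}" "p \<in> {1..v} \<times> {1..v}"
  shows "layer A d i p \<in> {0, 1}"
  using assms binary_cube_entry by (cases d; cases p) auto

lemma layer_product_eq_0_iff:
  "layer_product v M N = 0 \<longleftrightarrow> (\<forall>p\<in>{1..v} \<times> {1..v}. M p = 0 \<or> N p = 0)"
  unfolding layer_product_def by (subst sum_eq_0_iff) auto

lemma layer_product_eq_0_disjoint:
  assumes "layer_product v M N = 0"
  shows "{p \<in> {1..v} \<times> {1..v}. M p = 1} \<inter> {p \<in> {1..v} \<times> {1..v}. N p = 1} = {}"
proof (rule equals0I)
  fix p assume p: "p \<in> {p \<in> {1..v} \<times> {1..v}. M p = 1} \<inter> {p \<in> {1..v} \<times> {1..v}. N p = 1}"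
  then have "p \<in> {1..v} \<times> {1..v}"
    by blast
  then have "M p = 0 \<or> N p = 0"
    by (rule bspec[OF assms[unfolded layer_product_eq_0_iff]])
  then show False
    using p by simp
qed

text \<open>This turns the conditions on layers into a condition on lines, from which both claims of
  the theorem are derived.\<close>

lemma propriety3_cubes_iff:
  "A \<in> propriety3_cubes v v 0 \<longleftrightarrow> A \<in> binary_cubes v \<and> single_one_lines v A"
proof
  assume A: "A \<in> propriety3_cubes v v 0"
  then have bin: "A \<in> binary_cubes v"
    unfolding propriety3_cubes_def by blast
  have "\<exists>!i. i \<in> {1..v} \<and> layer A d i p = 1" if p: "p \<in> {1..v} \<times> {1..v}" for d p
  proof -
    have "\<exists>!i. i \<in> {1..v} \<and> p \<in> {p \<in> {1..v} \<times> {1..v}. layer A d i p = 1}"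
    \<comment> \<open>The count is exact: \<open>v\<close> layers with \<open>v\<close> ones each
      against \<open>v * v\<close> positions.\<close>
    proof (rule disjoint_covering_ex1[where P = "{1..v} \<times> {1..v}" and k = v])
      show "card {p \<in> {1..v} \<times> {1..v}. layer A d i p = 1} = v" if "i \<in> {1..v}" for i
        using A that unfolding propriety3_cubes_def by blast
      show "{p \<in> {1..v} \<times> {1..v}. layer A d i p = 1} \<inter>
          {p \<in> {1..v} \<times> {1..v}. layer A d j p = 1} = {}"
        if "i \<in> {1..v}" "j \<in> {1..v}" "i \<noteq> j" for i j
      proof -
        have "layer_product v (layer A d i) (layer A d j) = 0"
          using A that unfolding propriety3_cubes_def by blast
        then show ?thesis
          by (rule layer_product_eq_0_disjoint)
      qed
    qed (use p in auto)
    then show ?thesis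
      using p by simp
  qed
  with bin show "A \<in> binary_cubes v \<and> single_one_lines v A"
    unfolding single_one_lines_def by blast
next
  assume A: "A \<in> binary_cubes v \<and> single_one_lines v A"
  then have lines: "single_one_lines v A"
    by blast
  have "card {p \<in> {1..v} \<times> {1..v}. layer A d i p = 1} = v" if i: "i \<in> {1..v}" for d i
  proof -
    \<comment> \<open>A row of a layer is itself a line of the cube, in direction \<open>Z\<close>,
      or \<open>Y\<close> if \<open>d\<close> is \<open>Z\<close>.\<close>
    have "\<exists>!q. q \<in> {1..v} \<and> layer A d i (p, q) = 1" if "p \<in> {1..v}" for p
      using lines i that unfolding single_one_lines_iff by (cases d) auto
    then have "card {(p, q). p \<in> {1..v} \<and> q \<in> {1..v} \<and> layer A d i (p, q) = 1} = card {1..v}"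
      by (intro card_functional_relation) auto
    moreover have "{(p, q). p \<in> {1..v} \<and> q \<in> {1..v} \<and> layer A d i (p, q) = 1} =
        {p \<in> {1..v} \<times> {1..v}. layer A d i p = 1}"
      by auto
    ultimately show ?thesis
      by simp
  qed
  moreover have "layer_product v (layer A d i) (layer A d j) = 0"
    if "i \<in> {1..v}" "j \<in> {1..v}" "i \<noteq> j" for d i j
    unfolding layer_product_eq_0_iff
  proof
    fix p assume p: "p \<in> {1..v} \<times> {1..v}"
    \<comment> \<open>Both entries lie on the line in direction \<open>d\<close> through
      \<open>p\<close>, at distinct places.\<close>
    have "\<not> (layer A d i p = 1 \<and> layer A d j p = 1)"
      using lines p that unfolding single_one_lines_def by blast
    moreover have "layer A d k p \<in> {0, 1}" if "k \<in> {1..v}" for k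
      by (rule binary_cube_layer_entry[OF conjunct1[OF A] that p])
    from this[OF \<open>i \<in> {1..v}\<close>] this[OF \<open>j \<in> {1..v}\<close>]
    have "layer A d i p = 0 \<or> layer A d i p = 1" "layer A d j p = 0 \<or> layer A d j p = 1"
      by simp_all
    ultimately show "layer A d i p = 0 \<or> layer A d j p = 0"
      by metis
  qed
  ultimately show "A \<in> propriety3_cubes v v 0"
    using A unfolding propriety3_cubes_def by blast
qed

section \<open>Layers as symmetric designs\<close>

text \<open>Distinct rows never have a 1 in the same column, nor distinct columns in the same row,
  so every term of each scalar product vanishes.\<close>

lemma permutation_matrix_symmetric_design:
  assumes bin: "\<And>r c. r \<in> {1..v} \<Longrightarrow> c \<in> {1..v} \<Longrightarrow> M (r, c) \<in> {0, 1}"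
    and rows: "\<And>r. r \<in> {1..v} \<Longrightarrow> \<exists>!c. c \<in> {1..v} \<and> M (r, c) = 1"
    and cols: "\<And>c. c \<in> {1..v} \<Longrightarrow> \<exists>!r. r \<in> {1..v} \<and> M (r, c) = 1"
  shows "symmetric_design_matrix v 1 0 M"
proof -
  have "M (r, c) * M (s, c) = 0"
    if "r \<in> {1..v}" "s \<in> {1..v}" "r \<noteq> s" "c \<in> {1..v}" for r s c
    using bin[of r c] bin[of s c] cols[of c] that by auto
  moreover have "M (r, c) * M (r, d) = 0"
    if "c \<in> {1..v}" "d \<in> {1..v}" "c \<noteq> d" "r \<in> {1..v}" for c d r
    using bin[of r c] bin[of r d] rows[of r] that by auto
  ultimately show ?thesis
    unfolding symmetric_design_matrix_def
    by (intro conjI ballI impI bin card_ex1 rows cols sum.neutral) auto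
qed

text \<open>Rows and columns of a layer are lines of the cube, so each layer is a permutation
  matrix. The parameters 1 and 0 are the same for all layers.\<close>

lemma single_one_lines_propriety2:
  assumes "A \<in> binary_cubes v" "single_one_lines v A"
  shows "propriety2 v A"
proof -
  have "symmetric_design_matrix v 1 0 (layer A d i)" if "i \<in> {1..v}" for d i
  proof (rule permutation_matrix_symmetric_design)
    show "layer A d i (r, c) \<in> {0, 1}" if "r \<in> {1..v}" "c \<in> {1..v}" for r c
      using binary_cube_layer_entry assms(1) \<open>i \<in> {1..v}\<close> that by blast
    show "\<exists>!c. c \<in> {1..v} \<and> layer A d i (r, c) = 1" if "r \<in> {1..v}" for r
      using assms(2) \<open>i \<in> {1..v}\<close> that unfolding single_one_lines_iff by (cases d) auto
    show "\<exists>!r. r \<in> {1..v} \<and> layer A d i (r, c) = 1" if "c \<in> {1..v}" for c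
      using assms(2) \<open>i \<in> {1..v}\<close> that unfolding single_one_lines_iff by (cases d) auto
  qed
  then show ?thesis
    using assms(1) unfolding propriety2_def by blast
qed

section \<open>The correspondence with Latin squares\<close>

lemma latin_cube_eq_1_iff:
  assumes "x \<in> {1..v}" "y \<in> {1..v}" "z \<in> {1..v}"
  shows "latin_cube v L (x, y, z) = 1 \<longleftrightarrow> L (x, y) = z"
  using assms by (simp add: latin_cube_def)

lemma latin_cube_binary: "latin_cube v L \<in> binary_cubes v"
  unfolding latin_cube_def binary_cubes_def restrict_PiE_iff by auto

lemma latin_squaresD:
  assumes "L \<in> latin_squares v"
  shows "L \<in> {1..v} \<times> {1..v} \<rightarrow>\<^sub>E {1..v}"
    and "x \<in> {1..v} \<Longrightarrow> s \<in> {1..v} \<Longrightarrow> \<exists>!y. y \<in> {1..v} \<and> L (x, y) = s"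
    and "y \<in> {1..v} \<Longrightarrow> s \<in> {1..v} \<Longrightarrow> \<exists>!x. x \<in> {1..v} \<and> L (x, y) = s"
  using assms by (simp_all only: latin_squares_def mem_Collect_eq)

lemma latin_square_entry:
  "L \<in> latin_squares v \<Longrightarrow> x \<in> {1..v} \<Longrightarrow> y \<in> {1..v} \<Longrightarrow> L (x, y) \<in> {1..v}"
  by (rule PiE_mem[OF latin_squaresD(1)]) simp_all

text \<open>Lines in direction \<open>X\<close> express that a symbol occurs once in a column, lines
  in direction \<open>Y\<close> that it occurs once in a row, and lines in direction
  \<open>Z\<close> that each cell holds one symbol.\<close>

lemma single_one_lines_latin_cube:
  assumes L: "L \<in> latin_squares v"
  shows "single_one_lines v (latin_cube v L)"
  unfolding single_one_lines_iff
proof (intro conjI ballI)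
  fix p q assume pq: "p \<in> {1..v}" "q \<in> {1..v}"
  show "\<exists>!i. i \<in> {1..v} \<and> latin_cube v L (i, p, q) = 1"
    using latin_squaresD(3)[OF L pq] pq by (simp only: latin_cube_eq_1_iff cong: conj_cong)
  show "\<exists>!i. i \<in> {1..v} \<and> latin_cube v L (p, i, q) = 1"
    using latin_squaresD(2)[OF L pq] pq by (simp only: latin_cube_eq_1_iff cong: conj_cong)
  have "\<exists>!i. i \<in> {1..v} \<and> L (p, q) = i"
    using latin_square_entry[OF L pq] by blast
  then show "\<exists>!i. i \<in> {1..v} \<and> latin_cube v L (p, q, i) = 1"
    using pq by (simp only: latin_cube_eq_1_iff cong: conj_cong)
qed

lemma inj_on_latin_cube: "inj_on (latin_cube v) (latin_squares v)"
proof (rule inj_onI)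
  fix L M
  assume L: "L \<in> latin_squares v" and M: "M \<in> latin_squares v"
    and eq: "latin_cube v L = latin_cube v M"
  have "L (x, y) = M (x, y)" if "x \<in> {1..v}" "y \<in> {1..v}" for x y
    \<comment> \<open>Compare the two cubes at height \<open>L (x, y)\<close>, which lies in
      range.\<close>
    using latin_square_entry[OF L that] that eq latin_cube_eq_1_iff by metis
  moreover have "L \<in> extensional ({1..v} \<times> {1..v})" "M \<in> extensional ({1..v} \<times> {1..v})"
    using latin_squaresD(1)[OF L] latin_squaresD(1)[OF M] by (simp_all only: PiE_def Int_iff)
  ultimately show "L = M"
    by (intro extensionalityI) auto
qed

lemma single_one_lines_in_image_latin_cube:
  assumes A: "A \<in> binary_cubes v" and lines: "single_one_lines v A"
  shows "A \<in> latin_cube v ` latin_squares v"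
proof
  \<comment> \<open>\<open>L\<close> records the place of the 1 on each line in direction
    \<open>Z\<close>; the restriction makes it extensional.\<close>
  define L where
    "L = (\<lambda>(x, y) \<in> {1..v} \<times> {1..v}. THE z. z \<in> {1..v} \<and> A (x, y, z) = 1)"
  have L: "L (x, y) \<in> {1..v} \<and> A (x, y, L (x, y)) = 1" if "x \<in> {1..v}" "y \<in> {1..v}" for x y
  proof -
    from theI'[OF single_one_linesD(3)[OF lines that]] show ?thesis
      using that by (simp add: L_def)
  qed
  have L_iff: "L (x, y) = z \<longleftrightarrow> A (x, y, z) = 1"
    if "x \<in> {1..v}" "y \<in> {1..v}" "z \<in> {1..v}" for x y z
    using single_one_linesD(3)[OF lines that(1,2)] L[OF that(1,2)] that(3) by metis
  have "L \<in> ({1..v} \<times> {1..v}) \<rightarrow>\<^sub>E {1..v}"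
  proof (rule PiE_I)
    fix p assume "p \<in> {1..v} \<times> {1..v}"
    then show "L p \<in> {1..v}"
      using L by blast
  next
    fix p assume "p \<notin> {1..v} \<times> {1..v}"
    then show "L p = undefined"
      by (simp only: L_def restrict_apply if_False)
  qed
  moreover have "\<exists>!y. y \<in> {1..v} \<and> L (x, y) = s" if "x \<in> {1..v}" "s \<in> {1..v}" for x s
    using single_one_linesD(2)[OF lines that] that by (simp only: L_iff cong: conj_cong)
  moreover have "\<exists>!x. x \<in> {1..v} \<and> L (x, y) = s" if "y \<in> {1..v}" "s \<in> {1..v}" for y s
    using single_one_linesD(1)[OF lines that] that by (simp only: L_iff cong: conj_cong)
  ultimately show "L \<in> latin_squares v"
    unfolding latin_squares_def by (intro CollectI conjI ballI)
  show "A = latin_cube v L"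
  proof (rule extensionalityI)
    show "A \<in> extensional ({1..v} \<times> {1..v} \<times> {1..v})"
      using A by (simp only: binary_cubes_def PiE_def Int_iff)
    show "latin_cube v L \<in> extensional ({1..v} \<times> {1..v} \<times> {1..v})"
      unfolding latin_cube_def by (rule restrict_extensional)
    fix t assume "t \<in> {1..v} \<times> {1..v} \<times> {1..v}"
    then obtain x y z where t: "t = (x, y, z)" and
      xyz: "x \<in> {1..v}" "y \<in> {1..v}" "z \<in> {1..v}"
      by blast
    \<comment> \<open>\<open>L_iff\<close> only locates the ones; the other entries are 0 because
      \<open>A\<close> is binary.\<close>
    have "A t = (if L (x, y) = z then 1 else 0)"
      unfolding t using binary_cube_entry[OF A xyz] L_iff[OF xyz] by auto
    also have "\<dots> = latin_cube v L t"
      using t xyz by (simp add: latin_cube_def)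
    finally show "A t = latin_cube v L t" .
  qed
qed

theorem proposition2p7:
  fixes v :: nat
  shows "(\<forall>A \<in> propriety3_cubes v v 0. propriety2 v A) \<and>
         bij_betw (latin_cube v) (latin_squares v) (propriety3_cubes v v 0)"
proof
  show "\<forall>A \<in> propriety3_cubes v v 0. propriety2 v A"
    by (simp add: propriety3_cubes_iff single_one_lines_propriety2)
  have "latin_cube v ` latin_squares v = propriety3_cubes v v 0"
    using latin_cube_binary single_one_lines_latin_cube single_one_lines_in_image_latin_cube
    by (auto simp: propriety3_cubes_iff)
  then show "bij_betw (latin_cube v) (latin_squares v) (propriety3_cubes v v 0)"
    by (simp add: bij_betw_def inj_on_latin_cube)
qed

end
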